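(* Let $H$ be a BLS-hole and $R$ its unique rightmost edge. Let $L_1,\dots,L_k$ be the leftmost edges of $H$ listed in clockwise order, with $L_1$ the first such edge following $R$ in clockwise order, and let $N_2,\dots,N_k$ be the left notches of $H$ in clockwise order, with $N_2$ the first left notch following $R$ in clockwise order. Then a clockwise traversal of the boundary of $H$ starting at $R$ traverses these edges in the order $$R,L_1,N_2,L_2,N_3,\dots,N_k,L_k,R.$$ Moreover, if $H$ contains a falling corner $c_f$, then $c_f$ is traversed between $L_k$ and $R$.
   Context: A hole is a set $H=J\cup I$ where $J$ is a closed rectilinear arc (a closed Jordan curve that is a finite union of axis-parallel segments) and $I$ its bounded inner region. Edges of $H$ are the maximal straight segments of $J$ (consecutive edges are perpendicular), vertices the points where two edges meet. Traversing $J$ clockwise, each edge is leftward, rightward, upward or downward according to its direction of traversal. For a vertical edge $e$ whose two adjacent horizontal edges both extend to the left of $e$: $e$ is a rightmost edge if the interior of $H$ near $e$ lies to the left of $e$, and a left notch if it lies to the right. For a vertical edge whose two adjacent horizontal edges both extend to the right: it is a leftmost edge if the interior near it lies to its right, and a right notch if to its left. A horizontal edge whose two adjacent vertical edges both extend above it is a top notch if the interior near it lies below it. A falling corner is a vertex whose clockwise-preceding edge is downward and clockwise-succeeding edge is rightward. A BLS-hole is a hole containing no right notch, no top notch, and at most one falling corner. A BLS-hole has exactly one rightmost edge, and a BLS-hole with $k$ leftmost edges has exactly $k-1$ left notches. *)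

theory Defs
  imports "HOL-Complex_Analysis.Complex_Analysis"
begin

definition closed_rectilinear_arc :: "complex set \<Rightarrow> bool" where
  "closed_rectilinear_arc J \<longleftrightarrow>
     (\<exists>g. simple_path g \<and> pathfinish g = pathstart g \<and> path_image g = J) \<and>
     (\<exists>S. finite S \<and> J = \<Union>S \<and>
        (\<forall>s\<in>S. \<exists>a b. (Re a = Re b \<or> Im a = Im b) \<and> s = closed_segment a b))"

definition hole :: "complex set \<Rightarrow> bool" where
  "hole H \<longleftrightarrow> (\<exists>J. closed_rectilinear_arc J \<and> H = J \<union> inside J)"

fun polygonal_path :: "complex \<Rightarrow> complex list \<Rightarrow> real \<Rightarrow> complex" where
  "polygonal_path a [] = linepath a a"
| "polygonal_path a [b] = linepath a b"
| "polygonal_path a (b # c # vs) = linepath a b +++ polygonal_path b (c # vs)"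

definition closed_polygonal_path :: "complex list \<Rightarrow> real \<Rightarrow> complex" where
  "closed_polygonal_path vs = polygonal_path (hd vs) (tl vs @ [hd vs])"

text \<open>Vertices and edges are identified with indices modulo the length of the cyclic vertex list:
  edge \<open>i\<close> runs from vertex \<open>i\<close> to vertex \<open>i + 1\<close>. The predecessor of index \<open>i\<close> is written
  \<open>i + length vs - 1\<close>, since subtraction on \<^typ>\<open>nat\<close> truncates.\<close>

definition vertex :: "complex list \<Rightarrow> nat \<Rightarrow> complex" where
  "vertex vs i = vs ! (i mod length vs)"

definition rightward_edge :: "complex list \<Rightarrow> nat \<Rightarrow> bool" where
  "rightward_edge vs i \<longleftrightarrow>
     Im (vertex vs i) = Im (vertex vs (i + 1)) \<and> Re (vertex vs i) < Re (vertex vs (i + 1))"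

definition leftward_edge :: "complex list \<Rightarrow> nat \<Rightarrow> bool" where
  "leftward_edge vs i \<longleftrightarrow>
     Im (vertex vs i) = Im (vertex vs (i + 1)) \<and> Re (vertex vs i) > Re (vertex vs (i + 1))"

definition upward_edge :: "complex list \<Rightarrow> nat \<Rightarrow> bool" where
  "upward_edge vs i \<longleftrightarrow>
     Re (vertex vs i) = Re (vertex vs (i + 1)) \<and> Im (vertex vs i) < Im (vertex vs (i + 1))"

definition downward_edge :: "complex list \<Rightarrow> nat \<Rightarrow> bool" where
  "downward_edge vs i \<longleftrightarrow>
     Re (vertex vs i) = Re (vertex vs (i + 1)) \<and> Im (vertex vs i) > Im (vertex vs (i + 1))"

definition horizontal_edge :: "complex list \<Rightarrow> nat \<Rightarrow> bool" where
  "horizontal_edge vs i \<longleftrightarrow> rightward_edge vs i \<or> leftward_edge vs i"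

definition vertical_edge :: "complex list \<Rightarrow> nat \<Rightarrow> bool" where
  "vertical_edge vs i \<longleftrightarrow> upward_edge vs i \<or> downward_edge vs i"

text \<open>\<open>vs\<close> lists the vertices of \<open>H\<close> in the order of a clockwise traversal of its boundary.
  Perpendicularity of consecutive edges makes the sides of the polygon the maximal straight
  segments of the boundary curve; clockwise means winding number \<open>-1\<close> around inner points.\<close>

definition clockwise_vertices :: "complex set \<Rightarrow> complex list \<Rightarrow> bool" where
  "clockwise_vertices H vs \<longleftrightarrow>
     vs \<noteq> [] \<and>
     (\<forall>i < length vs. horizontal_edge vs i \<and> vertical_edge vs (i + 1) \<or>
                      vertical_edge vs i \<and> horizontal_edge vs (i + 1)) \<and>
     simple_path (closed_polygonal_path vs) \<and>
     H = path_image (closed_polygonal_path vs) \<union> inside (path_image (closed_polygonal_path vs)) \<and>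
     (\<forall>z \<in> inside (path_image (closed_polygonal_path vs)).
        winding_number (closed_polygonal_path vs) z = -1)"

text \<open>The interior of \<open>H\<close> near edge \<open>i\<close> lies on the side of the edge to which \<open>u\<close> points.\<close>

definition interior_towards :: "complex set \<Rightarrow> complex list \<Rightarrow> nat \<Rightarrow> complex \<Rightarrow> bool" where
  "interior_towards H vs i u \<longleftrightarrow>
     (\<forall>p \<in> open_segment (vertex vs i) (vertex vs (i + 1)).
        \<forall>\<^sub>F t in at_right 0. p + complex_of_real t * u \<in> interior H)"

definition neighbours_extend_left :: "complex list \<Rightarrow> nat \<Rightarrow> bool" where
  "neighbours_extend_left vs i \<longleftrightarrow>
     Re (vertex vs (i + length vs - 1)) < Re (vertex vs i) \<and>
     Re (vertex vs (i + 2)) < Re (vertex vs (i + 1))"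

definition neighbours_extend_right :: "complex list \<Rightarrow> nat \<Rightarrow> bool" where
  "neighbours_extend_right vs i \<longleftrightarrow>
     Re (vertex vs (i + length vs - 1)) > Re (vertex vs i) \<and>
     Re (vertex vs (i + 2)) > Re (vertex vs (i + 1))"

definition neighbours_extend_above :: "complex list \<Rightarrow> nat \<Rightarrow> bool" where
  "neighbours_extend_above vs i \<longleftrightarrow>
     Im (vertex vs (i + length vs - 1)) > Im (vertex vs i) \<and>
     Im (vertex vs (i + 2)) > Im (vertex vs (i + 1))"

definition rightmost_edge :: "complex set \<Rightarrow> complex list \<Rightarrow> nat \<Rightarrow> bool" where
  "rightmost_edge H vs i \<longleftrightarrow>
     i < length vs \<and> vertical_edge vs i \<and> neighbours_extend_left vs i \<and>
     interior_towards H vs i (-1)"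

definition left_notch :: "complex set \<Rightarrow> complex list \<Rightarrow> nat \<Rightarrow> bool" where
  "left_notch H vs i \<longleftrightarrow>
     i < length vs \<and> vertical_edge vs i \<and> neighbours_extend_left vs i \<and>
     interior_towards H vs i 1"

definition leftmost_edge :: "complex set \<Rightarrow> complex list \<Rightarrow> nat \<Rightarrow> bool" where
  "leftmost_edge H vs i \<longleftrightarrow>
     i < length vs \<and> vertical_edge vs i \<and> neighbours_extend_right vs i \<and>
     interior_towards H vs i 1"

definition right_notch :: "complex set \<Rightarrow> complex list \<Rightarrow> nat \<Rightarrow> bool" where
  "right_notch H vs i \<longleftrightarrow>
     i < length vs \<and> vertical_edge vs i \<and> neighbours_extend_right vs i \<and>
     interior_towards H vs i (-1)"

definition top_notch :: "complex set \<Rightarrow> complex list \<Rightarrow> nat \<Rightarrow> bool" where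
  "top_notch H vs i \<longleftrightarrow>
     i < length vs \<and> horizontal_edge vs i \<and> neighbours_extend_above vs i \<and>
     interior_towards H vs i (- \<i>)"

definition falling_corner :: "complex list \<Rightarrow> nat \<Rightarrow> bool" where
  "falling_corner vs i \<longleftrightarrow>
     i < length vs \<and> downward_edge vs (i + length vs - 1) \<and> rightward_edge vs i"

text \<open>The clockwise vertex list of a hole is determined up to rotation, which does not affect the
  conditions below.\<close>

definition BLS_hole :: "complex set \<Rightarrow> bool" where
  "BLS_hole H \<longleftrightarrow> hole H \<and>
     (\<forall>vs. clockwise_vertices H vs \<longrightarrow>
        (\<nexists>i. right_notch H vs i) \<and> (\<nexists>i. top_notch H vs i) \<and>
        card {i. falling_corner vs i} \<le> 1)"

text \<open>The edges in the order of one full clockwise traversal that starts at edge \<open>r\<close> and ends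
  when \<open>r\<close> is reached again.\<close>

definition edge_tour :: "complex list \<Rightarrow> nat \<Rightarrow> nat list" where
  "edge_tour vs r = rotate r [0..<length vs] @ [r]"

text \<open>For \<open>i, r < length vs\<close>: the number of edges that a clockwise traversal starting with edge \<open>r\<close>
  has completed when it first stands at vertex \<open>i\<close>, the starting point of edge \<open>i\<close>. Hence vertex
  \<open>j\<close> is met after edge \<open>i\<close> has been traversed, and before the traversal returns to \<open>r\<close>, iff
  \<open>steps_from vs r i < steps_from vs r j\<close>.\<close>

definition steps_from :: "complex list \<Rightarrow> nat \<Rightarrow> nat \<Rightarrow> nat" where
  "steps_from vs r i = (i + length vs - r) mod length vs"

end

theory Submission
  imports Defs "HOL-Number_Theory.Cong"
begin

text \<open>
  Crossing an edge from right to left raises the winding number by one, so the interior of a clockwise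
  polygon lies to the right of every edge. Hence a vertical edge between a leftward and a rightward edge
  is a leftmost edge (if upward) or a right notch (if downward), and one between a rightward and a
  leftward edge is a left notch (if upward) or a rightmost edge (if downward). Without right notches,
  leftmost edges therefore alternate with the left notches and rightmost edges taken together.

  That there is just one rightmost edge is Hopf's Umlaufsatz: right and left turns differ in number by
  four, and this difference is four times the number of rightmost edges minus that of right notches.

  A falling corner is followed by a downward edge, since there is no top notch, and then by a leftward
  edge, since there is no second falling corner. So it immediately precedes the rightmost edge.
\<close>

section \<open>Polygonal paths\<close>

lemma path_polygonal_path [simp]:
  "path (polygonal_path a bs)" "pathstart (polygonal_path a bs) = a"
  "pathfinish (polygonal_path a bs) = last (a # bs)"
  by (induction a bs rule: polygonal_path.induct) auto

lemma path_image_polygonal_path: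
  "bs \<noteq> [] \<Longrightarrow> path_image (polygonal_path a bs) =
     (\<Union>i<length bs. closed_segment ((a # bs) ! i) (bs ! i))"
proof (induction a bs rule: polygonal_path.induct)
  case (3 a b c vs)
  have "{..<length (b # c # vs)} = insert 0 (Suc ` {..<length (c # vs)})"
    by (auto simp: lessThan_Suc_eq_insert_0)
  with 3 show ?case by (simp add: path_image_join)
qed (auto simp: lessThan_Suc)

lemma winding_number_polygonal_path:
  "bs \<noteq> [] \<Longrightarrow> z \<notin> path_image (polygonal_path a bs) \<Longrightarrow>
    winding_number (polygonal_path a bs) z =
      (\<Sum>i<length bs. winding_number (linepath ((a # bs) ! i) (bs ! i)) z)"
proof (induction a bs rule: polygonal_path.induct)
  case (3 a b c vs)
  from 3 show ?case
    by (simp add: path_image_join winding_number_join sum.lessThan_Suc_shift del: sum.lessThan_Suc)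
qed auto

text \<open>The parameter at which a polygonal path with \<open>k\<close> edges has covered the fraction \<open>u\<close> of edge
  \<open>i\<close>; joining paths halves the parameter interval at every edge.\<close>

fun polygonal_time :: "nat \<Rightarrow> nat \<Rightarrow> real \<Rightarrow> real" where
  "polygonal_time (Suc (Suc k)) 0 u = u / 2"
| "polygonal_time (Suc (Suc k)) (Suc i) u = 1 / 2 + polygonal_time (Suc k) i u / 2"
| "polygonal_time _ _ u = u"

lemma polygonal_time_bounds:
  "0 \<le> u \<Longrightarrow> u < 1 \<Longrightarrow> 0 \<le> polygonal_time k i u \<and> polygonal_time k i u < 1"
  by (induction k i u rule: polygonal_time.induct) auto

text \<open>With fractions confined to a half-open interval, a vertex shared by two edges counts
  only as the start of the later one. Pairs of edge and fraction are then faithful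
  coordinates.\<close>

lemma polygonal_time_inj:
  "\<lbrakk>i < k; j < k; 0 \<le> u; u < 1; 0 \<le> v; v < 1; polygonal_time k i u = polygonal_time k j v\<rbrakk>
    \<Longrightarrow> i = j \<and> u = v"
proof (induction k i u arbitrary: j rule: polygonal_time.induct)
  case (1 k u)
  then show ?case using polygonal_time_bounds[of v "Suc k" "j - 1"] by (cases j) auto
next
  case (2 k i u)
  then show ?case using polygonal_time_bounds[of u "Suc k" i] by (cases j) auto
qed auto

lemma polygonal_path_at_time:
  "\<lbrakk>i < length bs; 0 \<le> u; u < 1\<rbrakk> \<Longrightarrow>
    polygonal_path a bs (polygonal_time (length bs) i u) = linepath ((a # bs) ! i) (bs ! i) u"
proof (induction a bs arbitrary: i rule: polygonal_path.induct)
  case (3 a b c vs)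
  show ?case
  proof (cases i)
    case 0
    with 3 show ?thesis by (simp add: joinpaths_def)
  next
    case (Suc j)
    let ?t = "polygonal_time (length (c # vs)) j u"
    have t: "0 \<le> ?t" "?t < 1" using polygonal_time_bounds 3 by blast+
    have IH: "polygonal_path b (c # vs) ?t = linepath ((b # c # vs) ! j) ((c # vs) ! j) u"
      using "3.IH"[of j] "3.prems" Suc by simp
    show ?thesis
    \<comment> \<open>At parameter 1/2 \<open>joinpaths\<close> evaluates the first path, so the
      start \<open>b\<close> of the remaining path is reached as the end of the first
      segment.\<close>
    proof (cases "?t = 0")
      case True
      with IH Suc show ?thesis
        using path_polygonal_path(2)[of b "c # vs"] by (simp add: joinpaths_def linepath_def pathstart_def)
    next
      case False
      with t IH Suc show ?thesis by (simp add: joinpaths_def)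
    qed
  qed
qed auto

text \<open>Passes from lists to cyclic indices, so that the edge closing the polygon is treated
  like every other edge.\<close>

lemma closed_polygonal_path_simps:
  assumes "vs \<noteq> []"
  shows "path (closed_polygonal_path vs)"
    "pathfinish (closed_polygonal_path vs) = pathstart (closed_polygonal_path vs)"
    "path_image (closed_polygonal_path vs) =
       (\<Union>i<length vs. closed_segment (vertex vs i) (vertex vs (Suc i)))"
    "z \<notin> path_image (closed_polygonal_path vs) \<Longrightarrow> winding_number (closed_polygonal_path vs) z =
       (\<Sum>i<length vs. winding_number (linepath (vertex vs i) (vertex vs (Suc i))) z)"
    "\<lbrakk>i < length vs; 0 \<le> u; u < 1\<rbrakk> \<Longrightarrow> closed_polygonal_path vs (polygonal_time (length vs) i u)
      = linepath (vertex vs i) (vertex vs (Suc i)) u"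
proof -
  have len: "length (tl vs @ [hd vs]) = length vs" using assms by simp
  have nth: "(hd vs # tl vs @ [hd vs]) ! i = vertex vs i" if "i < length vs" for i
    using assms that by (cases vs) (auto simp: vertex_def nth_append nth_Cons split: nat.split)
  have nth': "(tl vs @ [hd vs]) ! i = vertex vs (Suc i)" if "i < length vs" for i
    using assms that by (cases vs) (auto simp: vertex_def nth_append mod_Suc)
  note [simp] = closed_polygonal_path_def
  show "path (closed_polygonal_path vs)"
    "pathfinish (closed_polygonal_path vs) = pathstart (closed_polygonal_path vs)" by simp_all
  show "path_image (closed_polygonal_path vs) =
       (\<Union>i<length vs. closed_segment (vertex vs i) (vertex vs (Suc i)))"
    unfolding closed_polygonal_path_def
    by (subst path_image_polygonal_path) (use assms len nth nth' in auto)
  show "winding_number (closed_polygonal_path vs) z =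
       (\<Sum>i<length vs. winding_number (linepath (vertex vs i) (vertex vs (Suc i))) z)"
    if "z \<notin> path_image (closed_polygonal_path vs)"
    using that unfolding closed_polygonal_path_def
    by (subst winding_number_polygonal_path) (use assms len nth nth' in auto)
  show "closed_polygonal_path vs (polygonal_time (length vs) i u)
      = linepath (vertex vs i) (vertex vs (Suc i)) u" if "i < length vs" "0 \<le> u" "u < 1"
    using polygonal_path_at_time[of i "tl vs @ [hd vs]" u "hd vs"] that len nth nth' by simp
qed

text \<open>Times of fractions below 1 stay below 1, which excludes the coincidence of parameters 0
  and 1 that a simple closed path may have. All later use of simplicity goes through this
  lemma.\<close>

lemma simple_closed_polygonal_path_inj:
  assumes "vs \<noteq> []" "simple_path (closed_polygonal_path vs)"
    and "i < length vs" "j < length vs" "0 \<le> u" "u < 1" "0 \<le> v" "v < 1"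
    and eq: "linepath (vertex vs i) (vertex vs (Suc i)) u = linepath (vertex vs j) (vertex vs (Suc j)) v"
  shows "i = j \<and> u = v"
proof -
  let ?s = "polygonal_time (length vs) i u" and ?t = "polygonal_time (length vs) j v"
  have b: "0 \<le> ?s" "?s < 1" "0 \<le> ?t" "?t < 1" using polygonal_time_bounds assms by blast+
  have "closed_polygonal_path vs ?s = closed_polygonal_path vs ?t"
    using assms by (simp add: closed_polygonal_path_simps(5))
  then have "?s = ?t"
    using assms(2) b unfolding simple_path_def loop_free_def by fastforce
  then show ?thesis using polygonal_time_inj assms by blast
qed

section \<open>The turning number of a polygon with right angles\<close>

text \<open>A nonzero point of the closed right half-plane avoids the branch cut of
  \<open>Ln\<close>, so \<open>h\<close> minus the principal logarithm is continuous. Its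
  exponential is constant, so its values are discrete and it is constant itself. The change of
  argument can thus be read off at the end points.\<close>

lemma Im_log_change:
  fixes h :: "real \<Rightarrow> complex"
  assumes ab: "a \<le> b" and h: "continuous_on {a..b} h" and c: "c \<noteq> 0"
    and Re: "\<And>x. x \<in> {a..b} \<Longrightarrow> 0 \<le> Re (c * exp (h x))"
  shows "Im (h b) - Im (h a) = Im (Ln (c * exp (h b))) - Im (Ln (c * exp (h a)))"
proof -
  define k where "k = (\<lambda>x. h x - Ln (c * exp (h x)))"
  have "c * exp (h x) \<notin> \<real>\<^sub>\<le>\<^sub>0" if "x \<in> {a..b}" for x
    using Re[OF that] c by (metis complex_nonpos_Reals_iff antisym exp_not_eq_zero
        complex_eq_iff mult_eq_0_iff zero_complex.sel)
  then have "continuous_on {a..b} k"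
    unfolding k_def using h by (intro continuous_intros) auto
  moreover have expk: "exp (k x) = inverse c" for x
    using c by (simp add: k_def exp_diff field_simps)
  have "\<exists>e>0. \<forall>y. y \<in> {a..b} \<and> k y \<noteq> k x \<longrightarrow> e \<le> norm (k y - k x)" for x
  proof (intro exI[of _ "2 * pi"] conjI allI impI)
    fix y assume y: "y \<in> {a..b} \<and> k y \<noteq> k x"
    obtain n :: int where n: "k y = k x + (of_int (2 * n) * pi) * \<i>"
      using expk[of x] expk[of y] exp_eq[of "k y" "k x"] by auto
    with y have "n \<noteq> 0" by auto
    then have "1 \<le> \<bar>real_of_int n\<bar>" by linarith
    then show "2 * pi \<le> norm (k y - k x)"
      using n by (simp add: norm_mult)
  qed simp
  ultimately have "k constant_on {a..b}"
    by (intro continuous_discrete_range_constant) auto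
  then have "k a = k b"
    using ab by (auto simp: constant_on_def)
  then show ?thesis
    by (simp add: k_def complex_eq_iff)
qed

text \<open>Real and imaginary part of \<open>cnj z * w\<close> are the inner and the cross product.
  Both arguments are at most pi/2 in size, so their difference is at most pi; orthogonality makes
  its cosine vanish, and the cross product gives the sign of its sine.\<close>

lemma Im_Ln_diff_perpendicular:
  assumes "z \<noteq> 0" "w \<noteq> 0" "0 \<le> Re z" "0 \<le> Re w" and perp: "Re (cnj z * w) = 0"
  shows "Im (Ln w) - Im (Ln z) = sgn (Im (cnj z * w)) * (pi / 2)"
proof -
  define \<theta> where "\<theta> = Im (Ln w) - Im (Ln z)"
  have *: "\<bar>Im (Ln z)\<bar> \<le> pi/2" "\<bar>Im (Ln w)\<bar> \<le> pi/2"
    using assms Re_Ln_pos_le by auto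
  have "cnj z * w = exp (cnj (Ln z) + Ln w)"
    using assms by (simp add: exp_add flip: exp_cnj)
  then have e: "Re (cnj z * w) = exp (Re (cnj (Ln z) + Ln w)) * cos \<theta>"
     "Im (cnj z * w) = exp (Re (cnj (Ln z) + Ln w)) * sin \<theta>"
    by (simp_all add: Re_exp Im_exp \<theta>_def)
  then have c: "cos \<theta> = 0" using perp by simp
  have "\<bar>\<theta>\<bar> \<le> pi" using * unfolding \<theta>_def by linarith
  moreover have "cos \<bar>\<theta>\<bar> = 0" using c by (simp add: abs_if)
  ultimately have "\<bar>\<theta>\<bar> = pi/2"
    using cos_inj_pi[of "\<bar>\<theta>\<bar>" "pi/2"] by simp
  then have "\<theta> = pi/2 \<or> \<theta> = -(pi/2)" by linarith
  moreover have "sgn (Im (cnj z * w)) = sgn (sin \<theta>)"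
    unfolding e(2) by (simp add: sgn_mult)
  ultimately show ?thesis unfolding \<theta>_def[symmetric] by (elim disjE) simp_all
qed

text \<open>Hopf's Umlaufsatz for right angles: \<open>turn\<close> is 1 at a left and -1 at a right
  turn, and \<open>turn (n - 1)\<close> is the turn at the lowest vertex \<open>w 0\<close>. This
  quarter turn occurs three times on a detour through secants at \<open>w 0\<close> and once more as
  a summand.\<close>

lemma turn_sum_from_lowest_vertex:
  fixes w :: "nat \<Rightarrow> complex" and n :: nat
  defines "d \<equiv> \<lambda>i. w (Suc i) - w i"
  defines "turn \<equiv> \<lambda>i. sgn (Im (cnj (d i) * d (Suc i)))"
  assumes n: "2 \<le> n" and per: "\<And>i. w (i + n) = w i"
    and nz: "\<And>i. d i \<noteq> 0"
    and perp: "\<And>i. Re (cnj (d i) * d (Suc i)) = 0"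
    and inj: "\<And>i j u v. \<lbrakk>i < n; j < n; 0 \<le> u; u < 1; 0 \<le> v; v < 1;
                w i + of_real u * d i = w j + of_real v * d j\<rbrakk> \<Longrightarrow> i = j \<and> u = v"
    and low: "\<And>i. Im (w 0) \<le> Im (w i)"
  shows "(\<Sum>i<n. turn i) = 4 * turn (n - 1)"
proof -
  \<comment> \<open>Clamping makes \<open>g\<close> a finite sum of continuous terms: edge
    \<open>i\<close> is run through during [i, i + 1], and the point rests once \<open>m\<close>
    edges are done.\<close>
  define c :: "real \<Rightarrow> real" where "c = (\<lambda>t. max 0 (min 1 t))"
  define g where "g = (\<lambda>m t. w 0 + (\<Sum>i<m. of_real (c (t - real i)) * d i))"
  have g_end: "g m t = w m" if "real m \<le> t" for m t
    using that
  proof (induction m)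
    case (Suc m)
    then have "g m t = w m" by simp
    with Suc.prems show ?case by (simp add: g_def c_def d_def algebra_simps)
  qed (simp add: g_def)
  have g_eq: "g m (real j + u) = w j + of_real u * d j" if "j < m" "0 \<le> u" "u \<le> 1" for m j u
    using that
  proof (induction m)
    case (Suc m)
    show ?case
    proof (cases "j = m")
      case True
      then show ?thesis using Suc.prems g_end[of m "real m + u"] by (simp add: g_def c_def)
    next
      case False
      then have "real j + u - real m \<le> 0" using Suc.prems by linarith
      then show ?thesis using Suc False by (simp add: g_def c_def)
    qed
  qed simp
  define \<gamma> where "\<gamma> = g n"
  have cont: "continuous_on A \<gamma>" for A
    unfolding \<gamma>_def g_def c_def by (intro continuous_intros)
  have repr: "\<exists>i u. i < n \<and> 0 \<le> u \<and> u < 1 \<and> t = real i + u" if "0 \<le> t" "t < n" for t :: real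
    using that by (intro exI[of _ "nat \<lfloor>t\<rfloor>"] exI[of _ "frac t"])
      (auto simp: frac_def nat_less_iff floor_less_iff frac_lt_1[unfolded frac_def])
  have \<gamma>_inj: "s = t" if s: "0 \<le> s" "s < n" and t: "0 \<le> t" "t < n" and eq: "\<gamma> s = \<gamma> t" for s t :: real
  proof -
    obtain i u where iu: "i < n" "0 \<le> u" "u < 1" "s = real i + u" using repr[OF s] by blast
    obtain j v where jv: "j < n" "0 \<le> v" "v < 1" "t = real j + v" using repr[OF t] by blast
    have "w i + of_real u * d i = w j + of_real v * d j"
      using eq iu jv g_eq[of i n u] g_eq[of j n v] by (simp add: \<gamma>_def)
    then show ?thesis using inj iu jv by blast
  qed
  have \<gamma>0: "\<gamma> 0 = w 0" using g_eq[of 0 n 0] n by (simp add: \<gamma>_def)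
  have \<gamma>n: "\<gamma> n = w 0" using g_end[of n n] per[of 0] by (simp add: \<gamma>_def)
  \<comment> \<open>Hopf's argument: the secant direction has a continuous logarithm on \<open>K\<close>. Along the side
    \<open>t - s = 1\<close> it collects the turns, along each of the other three sides it stays in a half-plane.\<close>
  define K :: "(real \<times> real) set" where
    "K = {p. 0 \<le> fst p} \<inter> {p. snd p \<le> n} \<inter> {p. 1 \<le> snd p - fst p} \<inter> {p. snd p - fst p \<le> n - 1}"
  have K: "(s, t) \<in> K \<longleftrightarrow> 0 \<le> s \<and> t \<le> n \<and> 1 \<le> t - s \<and> t - s \<le> n - 1" for s t
    by (auto simp: K_def)
  \<comment> \<open>\<open>K\<close> is the triangle 0 <= s <= t <= n without a strip at the
    diagonal and the corner (0, n), where secants shrink to zero. What remains is convex, hence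
    contractible, which yields the logarithm.\<close>
  have "convex K"
  proof -
    have "K = {p. (- 1, 0) \<bullet> p \<le> 0} \<inter> {p. (0, 1) \<bullet> p \<le> n} \<inter>
        {p. (1, - 1) \<bullet> p \<le> - 1} \<inter> {p. (- 1, 1) \<bullet> p \<le> n - 1}"
      by (auto simp: K_def inner_prod_def)
    then show ?thesis by (simp add: convex_Int convex_halfspace_le)
  qed
  define D where "D = (\<lambda>p. \<gamma> (snd p) - \<gamma> (fst p))"
  have Dnz: "D p \<noteq> 0" if "p \<in> K" for p
  proof
    obtain s t where p: "p = (s, t)" by fastforce
    assume "D p = 0"
    then have eq: "\<gamma> s = \<gamma> t" by (simp add: D_def p)
    have st: "0 \<le> s" "t \<le> n" "1 \<le> t - s" "t - s \<le> n - 1" using that by (auto simp: K p)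
    show False
    \<comment> \<open>Injectivity holds on [0, n) only. At \<open>t = n\<close> the point is
      \<open>\<gamma> 0\<close>, and \<open>s = 0\<close> contradicts
      \<open>t - s \<le> n - 1\<close>.\<close>
    proof (cases "t = n")
      case True
      then have "s = 0" using \<gamma>_inj[of s 0] eq \<gamma>0 \<gamma>n st n by auto
      then show False using st True n by linarith
    next
      case False
      then show False using \<gamma>_inj[of s t] eq st n by linarith
    qed
  qed
  have "continuous_on K D"
    unfolding D_def by (intro continuous_intros continuous_on_compose2[OF cont]) auto
  then obtain h where h: "continuous_on K h" "\<And>p. p \<in> K \<Longrightarrow> D p = exp (h p)"
    by (rule continuous_logarithm_on_contractible)
      (use \<open>convex K\<close> Dnz in \<open>auto intro: convex_imp_contractible\<close>)
  \<comment> \<open>The factor \<open>k\<close> rotates the half-plane containing the secants along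
    \<open>q\<close> to the right one. It scales the cross product by a positive number and so keeps
    its sign.\<close>
  have step: "Im (h (q b)) - Im (h (q a)) = sgn (Im (cnj (D (q a)) * D (q b))) * (pi / 2)"
    if "a \<le> b" "continuous_on {a..b} q" "\<And>x. x \<in> {a..b} \<Longrightarrow> q x \<in> K" "k \<noteq> 0"
      "\<And>x. x \<in> {a..b} \<Longrightarrow> 0 \<le> Re (k * D (q x))" "Re (cnj (D (q a)) * D (q b)) = 0"
    for a b :: real and q k
  proof -
    have q: "q a \<in> K" "q b \<in> K" using that by auto
    have E: "cnj (k * D (q a)) * (k * D (q b)) = (norm k)\<^sup>2 *\<^sub>R (cnj (D (q a)) * D (q b))"
      unfolding scaleR_conv_of_real complex_norm_square complex_cnj_mult by (simp only: mult_ac)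
    have "Im (h (q b)) - Im (h (q a)) = Im (Ln (k * exp (h (q b)))) - Im (Ln (k * exp (h (q a))))"
      using that h by (intro Im_log_change continuous_on_compose2[OF h(1)]) auto
    also have "\<dots> = Im (Ln (k * D (q b))) - Im (Ln (k * D (q a)))"
      using q h(2) by simp
    also have "\<dots> = sgn (Im (cnj (k * D (q a)) * (k * D (q b)))) * (pi / 2)"
    proof (rule Im_Ln_diff_perpendicular)
      show "Re (cnj (k * D (q a)) * (k * D (q b))) = 0"
        unfolding E scaleR_complex.sel that(6) by simp
      show "0 \<le> Re (k * D (q a))" "0 \<le> Re (k * D (q b))"
        using that(1) that(5)[of a] that(5)[of b] by auto
    qed (use that q Dnz in auto)
    also have "\<dots> = sgn (Im (cnj (D (q a)) * D (q b))) * (pi / 2)"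
      unfolding E scaleR_complex.sel by (simp add: sgn_mult that)
    finally show ?thesis .
  qed
  have \<gamma>: "\<gamma> (real j + u) = w j + of_real u * d j" if "j < n" "0 \<le> u" "u \<le> 1" for j u
    using g_eq that by (simp add: \<gamma>_def)
  have dn: "d (Suc (n - 1)) = d 0" "w (Suc (n - 1)) = w 0"
    using n per[of 0] per[of 1] by (auto simp: d_def)
  \<comment> \<open>As both ends move along consecutive edges, the secant interpolates between
    \<open>d i\<close> and \<open>d (Suc i)\<close>, so its inner product with \<open>d i\<close> is
    never negative.\<close>
  have diag: "Im (h (real m, real m + 1)) - Im (h (0, 1)) = (\<Sum>i<m. turn i) * (pi / 2)" if "m < n" for m
    using that
  proof (induction m)
    case (Suc i)
    define q where "q = (\<lambda>x::real. (x, x + 1))"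
    have Dq: "D (q (real i + u)) = d i + of_real u * (d (Suc i) - d i)" if "0 \<le> u" "u \<le> 1" for u
    proof -
      have "D (q (real i + u)) = \<gamma> (real (Suc i) + u) - \<gamma> (real i + u)"
        by (simp add: D_def q_def add_ac)
      also have "\<dots> = w (Suc i) + of_real u * d (Suc i) - (w i + of_real u * d i)"
        using \<gamma>[of i u] \<gamma>[of "Suc i" u] Suc.prems that by simp
      finally show ?thesis by (simp add: d_def algebra_simps)
    qed
    have "D (q (real i)) = d i" "D (q (real (Suc i))) = d (Suc i)"
      using Dq[of 0] Dq[of 1] by (simp_all add: add.commute)
    moreover have "Im (h (q (real (Suc i)))) - Im (h (q (real i)))
        = sgn (Im (cnj (D (q (real i))) * D (q (real (Suc i))))) * (pi / 2)"
    proof (rule step[where k = "cnj (d i)"])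
      show "q x \<in> K" if "x \<in> {real i..real (Suc i)}" for x
        using that Suc.prems n by (auto simp: q_def K)
      show "0 \<le> Re (cnj (d i) * D (q x))" if "x \<in> {real i..real (Suc i)}" for x
      proof -
        define u where "u = x - real i"
        have u: "0 \<le> u" "u \<le> 1" "x = real i + u" using that by (auto simp: u_def)
        have "Re (cnj (d i) * D (q x)) = (1 - u) * Re (cnj (d i) * d i) + u * Re (cnj (d i) * d (Suc i))"
          unfolding u(3) Dq[OF u(1,2)] by (simp add: algebra_simps)
        also have "\<dots> = (1 - u) * ((Re (d i))\<^sup>2 + (Im (d i))\<^sup>2)"
          unfolding perp by (simp add: power2_eq_square)
        finally show ?thesis using u by simp
      qed
      show "continuous_on {real i..real (Suc i)} q" unfolding q_def by (intro continuous_intros)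
    qed (use nz perp calculation in auto)
    ultimately have "Im (h (real (Suc i), real (Suc i) + 1)) - Im (h (real i, real i + 1)) = turn i * (pi / 2)"
      by (simp add: q_def turn_def)
    then show ?case using Suc by (simp add: algebra_simps)
  qed simp
  have \<gamma>low: "Im (w 0) \<le> Im (\<gamma> t)" if t: "0 \<le> t" "t < n" for t :: real
  proof -
    obtain i u where iu: "i < n" "0 \<le> u" "u < 1" "t = real i + u" using repr[OF t] by blast
    have "Im (\<gamma> t) = (1 - u) * Im (w i) + u * Im (w (Suc i))"
      unfolding iu(4) using \<gamma>[of i u] iu(1-3) by (simp add: d_def) (simp add: algebra_simps)
    moreover have "(1 - u) * Im (w 0) \<le> (1 - u) * Im (w i)" "u * Im (w 0) \<le> u * Im (w (Suc i))"
      using iu low by (intro mult_left_mono; simp)+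
    ultimately show ?thesis by (simp add: algebra_simps)
  qed
  have \<gamma>1: "\<gamma> 1 - w 0 = d 0" using \<gamma>[of 0 1] n by (simp add: d_def)
  have \<gamma>m: "w 0 - \<gamma> (real n - 1) = d (n - 1)"
    using \<gamma>[of "n - 1" 0] n dn by (simp add: d_def of_nat_diff)
  have perp': "Re (cnj (d (n - 1)) * d 0) = 0" and turn': "turn (n - 1) = sgn (Im (cnj (d (n - 1)) * d 0))"
    using perp[of "n - 1"] unfolding turn_def dn by simp_all
  \<comment> \<open>Secants from the lowest vertex point into the upper half-plane, which
    \<open>- \<i>\<close> rotates to the right one.\<close>
  have 1: "Im (h (0, real n - 1)) - Im (h (0, 1)) = turn (n - 1) * (pi / 2)"
  proof -
    have D: "D (0, 1) = d 0" "D (0, real n - 1) = - d (n - 1)"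
      using \<gamma>1 \<gamma>m by (auto simp: D_def \<gamma>0 algebra_simps)
    have "Im (h (0, real n - 1)) - Im (h (0, 1)) = sgn (Im (cnj (D (0, 1)) * D (0, real n - 1))) * (pi / 2)"
    proof (rule step[where k = "- \<i>"])
      show "0 \<le> Re (- \<i> * D (0, x))" if "x \<in> {1..real n - 1}" for x
        using \<gamma>low[of x] that by (auto simp: D_def \<gamma>0)
    qed (use n perp' in \<open>auto simp: K D algebra_simps intro!: continuous_intros\<close>)
    then show ?thesis unfolding turn' D by (simp add: algebra_simps)
  qed
  \<comment> \<open>Here the secant interpolates between \<open>- d (n - 1)\<close> and
    \<open>- d 0\<close>, which is the quarter turn at the lowest vertex again.\<close>
  have 2: "Im (h (1, real n)) - Im (h (0, real n - 1)) = turn (n - 1) * (pi / 2)"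
  proof -
    define q where "q = (\<lambda>x::real. (x, real n - 1 + x))"
    have Dq: "D (q u) = - d (n - 1) + of_real u * (d (n - 1) - d 0)" if "0 \<le> u" "u \<le> 1" for u
    proof -
      have "D (q u) = \<gamma> (real (n - 1) + u) - \<gamma> (real 0 + u)"
        using n by (simp add: D_def q_def of_nat_diff)
      also have "\<dots> = w (n - 1) + of_real u * d (n - 1) - (w 0 + of_real u * d 0)"
        using \<gamma>[of 0 u] \<gamma>[of "n - 1" u] n that by simp
      finally show ?thesis using dn by (simp add: d_def algebra_simps)
    qed
    have D: "D (q 0) = - d (n - 1)" "D (q 1) = - d 0" using Dq[of 0] Dq[of 1] by auto
    have "Im (h (q 1)) - Im (h (q 0)) = sgn (Im (cnj (D (q 0)) * D (q 1))) * (pi / 2)"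
    proof (rule step[where k = "- cnj (d (n - 1))"])
      show "q x \<in> K" if "x \<in> {0..1}" for x
        using that n by (auto simp: q_def K)
      show "0 \<le> Re (- cnj (d (n - 1)) * D (q u))" if "u \<in> {0..1}" for u
      proof -
        have "Re (- cnj (d (n - 1)) * D (q u))
            = (1 - u) * Re (cnj (d (n - 1)) * d (n - 1)) + u * Re (cnj (d (n - 1)) * d 0)"
          using that by (subst Dq) (auto simp: algebra_simps)
        also have "\<dots> = (1 - u) * ((Re (d (n - 1)))\<^sup>2 + (Im (d (n - 1)))\<^sup>2)"
          unfolding perp' by (simp add: power2_eq_square)
        finally show ?thesis using that by simp
      qed
      show "continuous_on {0..1} q" unfolding q_def by (intro continuous_intros)
    qed (use nz perp' D in auto)
    then show ?thesis unfolding turn' D by (simp add: q_def)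
  qed
  \<comment> \<open>Secants ending at the lowest vertex point into the lower half-plane, hence the
    factor \<open>\<i>\<close>.\<close>
  have 3: "Im (h (real n - 1, real n)) - Im (h (1, real n)) = turn (n - 1) * (pi / 2)"
  proof -
    have D: "D (1, real n) = - d 0" "D (real n - 1, real n) = d (n - 1)"
      using \<gamma>1 \<gamma>m by (auto simp: D_def \<gamma>n algebra_simps)
    have "Im (h (real n - 1, real n)) - Im (h (1, real n))
        = sgn (Im (cnj (D (1, real n)) * D (real n - 1, real n))) * (pi / 2)"
    proof (rule step[where k = "\<i>" and q = "\<lambda>x. (x, real n)"])
      show "0 \<le> Re (\<i> * D (x, real n))" if "x \<in> {1..real n - 1}" for x
        using \<gamma>low[of x] that by (auto simp: D_def \<gamma>n)
    qed (use n perp' in \<open>auto simp: K D algebra_simps intro!: continuous_intros\<close>)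
    then show ?thesis unfolding turn' D by (simp add: algebra_simps)
  qed
  \<comment> \<open>Both ways along the boundary of \<open>K\<close> from (0, 1) to (n - 1, n)
    change \<open>h\<close> by the same amount: the first \<open>n - 1\<close> turns on one, three
    equal quarter turns on the other.\<close>
  have "(\<Sum>i<n - 1. turn i) * (pi / 2) = 3 * turn (n - 1) * (pi / 2)"
    using diag[of "n - 1"] 1 2 3 n by (simp add: of_nat_diff algebra_simps)
  then have "(\<Sum>i<n - 1. turn i) = 3 * turn (n - 1)" by simp
  moreover have "(\<Sum>i<n. turn i) = (\<Sum>i<n - 1. turn i) + turn (n - 1)"
    using n sum.lessThan_Suc[of turn "n - 1"] by simp
  ultimately show ?thesis by simp
qed

lemma sum_cyclic_shift:
  fixes f :: "nat \<Rightarrow> 'a :: cancel_comm_monoid_add"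
  assumes per: "\<And>i. f (i + n) = f i"
  shows "(\<Sum>i<n. f (i + k)) = (\<Sum>i<n. f i)"
proof (induction k)
  case (Suc k)
  have "(\<Sum>i<n. f (Suc i + k)) + f k = (\<Sum>i<Suc n. f (i + k))"
    by (subst sum.lessThan_Suc_shift) (simp add: add.commute)
  also have "\<dots> = (\<Sum>i<n. f (i + k)) + f k"
    using per[of k] by (simp add: add.commute)
  finally show ?case using Suc by simp
qed simp

text \<open>Renumbering cyclically puts a lowest vertex first. The orientation decides the sign of
  the turn there, hence the absolute value.\<close>

lemma perpendicular_polygon_turning_number:
  fixes w :: "nat \<Rightarrow> complex" and n :: nat
  defines "d \<equiv> \<lambda>i. w (Suc i) - w i"
  defines "turn \<equiv> \<lambda>i. sgn (Im (cnj (d i) * d (Suc i)))"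
  assumes n: "2 \<le> n" and per: "\<And>i. w (i + n) = w i"
    and nz: "\<And>i. d i \<noteq> 0"
    and perp: "\<And>i. Re (cnj (d i) * d (Suc i)) = 0"
    and inj: "\<And>i j u v. \<lbrakk>i < n; j < n; 0 \<le> u; u < 1; 0 \<le> v; v < 1;
                w i + of_real u * d i = w j + of_real v * d j\<rbrakk> \<Longrightarrow> i = j \<and> u = v"
  shows "\<bar>\<Sum>i<n. turn i\<bar> = 4"
proof -
  have per': "w (i + m * n) = w i" for i m
    by (induction m) (use per in \<open>simp_all add: add_ac, metis add.assoc add.commute\<close>)
  have wmod: "w (i mod n) = w i" for i
    using per'[of "i mod n" "i div n"] by simp
  have dmod: "d (i mod n) = d i" for i
    using per'[of "i mod n" "i div n"] per'[of "Suc (i mod n)" "i div n"] by (simp add: d_def)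
  obtain k where k: "k \<in> {..<n}" "\<And>i. i \<in> {..<n} \<Longrightarrow> Im (w k) \<le> Im (w i)"
    using ex_is_arg_min_if_finite[of "{..<n}" "\<lambda>i. Im (w i)"] n
    by (force simp: is_arg_min_linorder)
  define w' where "w' = (\<lambda>i. w (i + k))"
  have d': "w' (Suc i) - w' i = d (i + k)" for i by (simp add: w'_def d_def)
  have "(\<Sum>i<n. sgn (Im (cnj (w' (Suc i) - w' i) * (w' (Suc (Suc i)) - w' (Suc i)))))
      = 4 * sgn (Im (cnj (w' (Suc (n - 1)) - w' (n - 1)) * (w' (Suc (Suc (n - 1))) - w' (Suc (n - 1)))))"
  proof (rule turn_sum_from_lowest_vertex[OF n])
    show "w' (i + n) = w' i" for i using per[of "i + k"] by (simp add: w'_def add_ac)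
    show "Re (cnj (w' (Suc i) - w' i) * (w' (Suc (Suc i)) - w' (Suc i))) = 0" for i
      using perp[of "i + k"] by (simp only: d' add_Suc)
    show "Im (w' 0) \<le> Im (w' i)" for i
      using k(2)[of "(i + k) mod n"] n by (simp add: w'_def wmod)
    show "i = j \<and> u = v" if "i < n" "j < n" "0 \<le> u" "u < 1" "0 \<le> v" "v < 1"
      "w' i + of_real u * (w' (Suc i) - w' i) = w' j + of_real v * (w' (Suc j) - w' j)" for i j u v
    proof -
      have "(i + k) mod n = (j + k) mod n \<and> u = v"
        using that n by (intro inj) (simp_all only: d' wmod dmod, auto simp: w'_def)
      then have "[i + k = j + k] (mod n) \<and> u = v" by (simp add: cong_def)
      then show ?thesis using that cong_less_modulus_unique_nat[of i j n] by (simp add: cong_add_rcancel_nat)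
    qed
  qed (use nz d' in auto)
  then have "(\<Sum>i<n. turn (i + k)) = 4 * turn (n - 1 + k)"
    by (simp only: d' turn_def add_Suc)
  moreover have "turn (i + n) = turn i" for i
    using per[of i] per[of "Suc i"] per[of "Suc (Suc i)"] by (simp add: turn_def d_def)
  then have "(\<Sum>i<n. turn (i + k)) = (\<Sum>i<n. turn i)" by (rule sum_cyclic_shift)
  moreover have "\<bar>turn i\<bar> = 1" for i
  proof -
    have "cnj (d i) * d (Suc i) \<noteq> 0" using nz by simp
    then have "Im (cnj (d i) * d (Suc i)) \<noteq> 0" using perp[of i] by (auto simp only: complex_eq_iff zero_complex.sel)
    then show ?thesis unfolding turn_def by (simp only: abs_sgn_eq if_False)
  qed
  ultimately show ?thesis by (simp add: abs_mult)
qed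

section \<open>The side of an edge on which the interior lies\<close>

text \<open>The exponential fixes the left side up to multiples of 2 pi i, and a segment subtends
  less than a half turn, which singles out the principal value.\<close>

lemma winding_number_linepath_eq_Ln:
  assumes "z \<notin> closed_segment a b"
  shows "2 * pi * \<i> * winding_number (linepath a b) z = Ln ((b - z) / (a - z))"
proof -
  have "a \<noteq> z" using assms by auto
  have "b - z = exp (2 * pi * \<i> * winding_number (linepath a b) z) * (a - z)"
    using winding_number_exp_2pi[of "linepath a b" z] assms by simp
  then have "exp (2 * pi * \<i> * winding_number (linepath a b) z) = (b - z) / (a - z)"
    using \<open>a \<noteq> z\<close> by simp
  moreover have "\<bar>2 * Re (winding_number (linepath a b) z)\<bar> < 1"
    using winding_number_lt_half_linepath[OF assms] by simp
  then have "\<bar>pi * (2 * Re (winding_number (linepath a b) z))\<bar> < pi"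
    unfolding abs_mult by simp
  then have "- pi < Im (2 * pi * \<i> * winding_number (linepath a b) z)"
    "Im (2 * pi * \<i> * winding_number (linepath a b) z) < pi"
    unfolding abs_less_iff by (simp_all add: mult_ac)
  ultimately show ?thesis
    by (intro Ln_unique[symmetric]) auto
qed

lemma normal_displacement_notin_segment:
  fixes a b :: complex
  assumes "a \<noteq> b" "s \<noteq> 0"
  shows "a + of_real l * (b - a) - of_real s * \<i> * (b - a) \<notin> closed_segment a b"
proof
  assume "a + of_real l * (b - a) - of_real s * \<i> * (b - a) \<in> closed_segment a b"
  then obtain u where "a + of_real l * (b - a) - of_real s * \<i> * (b - a) = (1 - u) *\<^sub>R a + u *\<^sub>R b"
    by (auto simp: in_segment)
  then have "(of_real (l - u) - of_real s * \<i>) * (b - a) = 0"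
    by (simp add: algebra_simps scaleR_conv_of_real)
  then have "of_real (l - u) - of_real s * \<i> = 0"
    using assms(1) by simp
  then show False using assms(2) by (simp add: complex_eq_iff)
qed

text \<open>For \<open>r > 0\<close> the points approach the segment from its right, for \<open>r < 0\<close> from its left.\<close>

lemma winding_number_linepath_one_sided_limit:
  assumes "a \<noteq> b" and l: "0 < l" "l < 1" and r: "r \<noteq> 0"
  defines "p \<equiv> a + of_real l * (b - a)"
  shows "((\<lambda>t. Re (winding_number (linepath a b) (p - of_real (r * t) * \<i> * (b - a)))) \<longlongrightarrow> - sgn r / 2) (at_right 0)"
proof -
  define z where "z = (\<lambda>t::real. p - of_real (r * t) * \<i> * (b - a))"
  \<comment> \<open>The quotient in the logarithm tends to a negative real, on the branch cut. Its
    negative \<open>R\<close> tends to \<open>(1 - l) / l\<close>, where \<open>Ln\<close> is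
    continuous. Returning to \<open>- R\<close> costs \<open>sgn r * pi\<close>, as
    \<open>Im (R t)\<close> has the sign of \<open>r\<close>.\<close>
  define R where "R = (\<lambda>t::real. (of_real (1 - l) + \<i> * of_real (r * t)) / (of_real l - \<i> * of_real (r * t)))"
  have R: "(b - z t) / (a - z t) = - R t" if "t > 0" for t
  proof -
    have "b - z t = (of_real (1 - l) + \<i> * of_real (r * t)) * (b - a)"
      "a - z t = - (of_real l - \<i> * of_real (r * t)) * (b - a)"
      by (simp_all add: z_def p_def algebra_simps)
    then show ?thesis
      using assms(1) by (metis R_def minus_divide_right nonzero_mult_divide_mult_cancel_right right_minus_eq)
  qed
  have ImR: "Im (R t) = r * t / (l\<^sup>2 + (r * t)\<^sup>2)" for t
    by (simp add: R_def Im_divide algebra_simps)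
  have z: "z t \<notin> closed_segment a b" if "t > 0" for t
    using normal_displacement_notin_segment[of a b "r * t" l] assms that by (simp add: z_def)
  have lim: "(R \<longlongrightarrow> R 0) (at_right 0)"
    unfolding R_def using l by (intro tendsto_intros) (auto simp: complex_eq_iff)
  have R0: "R 0 = of_real ((1 - l) / l)" by (simp add: R_def)
  have "((\<lambda>t. (Im (Ln (R t)) - sgn r * pi) / (2 * pi)) \<longlongrightarrow> (Im (Ln (R 0)) - sgn r * pi) / (2 * pi)) (at_right 0)"
    using l by (intro tendsto_intros lim) (auto simp: R0 divide_le_0_iff simp del: of_real_divide)
  also have "Im (Ln (R 0)) = 0"
    unfolding R0 using l by (subst Ln_of_real) auto
  finally have "((\<lambda>t. (Im (Ln (R t)) - sgn r * pi) / (2 * pi)) \<longlongrightarrow> - sgn r / 2) (at_right 0)"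
    by simp
  moreover have "\<forall>\<^sub>F t in at_right 0. (Im (Ln (R t)) - sgn r * pi) / (2 * pi)
      = Re (winding_number (linepath a b) (z t))"
    using eventually_at_right_less
  proof eventually_elim
    case (elim t)
    have "2 * pi * Re (winding_number (linepath a b) (z t)) = Im (Ln (- R t))"
      unfolding R[OF elim, symmetric] winding_number_linepath_eq_Ln[OF z[OF elim], symmetric] by simp
    moreover have "Im (R t) \<noteq> 0" "sgn (Im (R t)) = sgn r"
      unfolding ImR using elim l r by (auto simp: sgn_mult sgn_divide sum_power2_eq_zero_iff add_pos_nonneg)
    moreover from this have "R t \<noteq> 0" by auto
    ultimately have "2 * pi * Re (winding_number (linepath a b) (z t)) = Im (Ln (R t)) - sgn r * pi"
      by (auto simp: Ln_minus sgn_if split: if_splits)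
    then show ?case by (simp add: field_simps)
  qed
  ultimately have "((\<lambda>t. Re (winding_number (linepath a b) (z t))) \<longlongrightarrow> - sgn r / 2) (at_right 0)"
    by (rule Lim_transform_eventually)
  then show ?thesis by (simp only: z_def)
qed

lemma vertex_mod [simp]: "vertex vs (i mod length vs) = vertex vs i"
  by (simp add: vertex_def)

lemma vertex_Suc_mod [simp]: "vertex vs (Suc (i mod length vs)) = vertex vs (Suc i)"
  by (simp add: vertex_def mod_Suc_eq)

lemma edge_point_notin_other_edge:
  assumes vs: "vs \<noteq> []" "simple_path (closed_polygonal_path vs)"
    and ij: "i < length vs" "j < length vs" "i \<noteq> j" and l: "0 < l" "l < 1"
  shows "linepath (vertex vs i) (vertex vs (Suc i)) l \<notin> closed_segment (vertex vs j) (vertex vs (Suc j))"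
proof
  assume "linepath (vertex vs i) (vertex vs (Suc i)) l \<in> closed_segment (vertex vs j) (vertex vs (Suc j))"
  then obtain u where u: "0 \<le> u" "u \<le> 1"
    and eq: "linepath (vertex vs i) (vertex vs (Suc i)) l = linepath (vertex vs j) (vertex vs (Suc j)) u"
    by (auto simp: in_segment linepath_def)
  show False
  \<comment> \<open>Injectivity covers fractions below 1, so the end of edge \<open>j\<close> is
    rewritten as the start of its successor; fraction 0 cannot equal \<open>l\<close>.\<close>
  proof (cases "u = 1")
    case True
    have "linepath (vertex vs i) (vertex vs (Suc i)) l
        = linepath (vertex vs (Suc j mod length vs)) (vertex vs (Suc (Suc j mod length vs))) 0"
      using eq True by (simp add: linepath_def)
    then have "l = 0"
      using simple_closed_polygonal_path_inj[OF vs, of i "Suc j mod length vs" l 0] ij l vs(1) by simp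
    then show False using l by simp
  next
    case False
    then show False
      using simple_closed_polygonal_path_inj[OF vs, of i j l u] eq ij l u by simp
  qed
qed

text \<open>As two points approach edge \<open>i\<close> from either side, its contributions to the
  winding number tend to -1/2 on the right and 1/2 on the left, while those of the other edges are
  continuous there and cancel.\<close>

lemma sides_of_edge:
  assumes cw: "clockwise_vertices H vs" and i: "i < length vs"
    and l: "0 < l" "l < 1" and r: "0 < r"
  defines "a \<equiv> vertex vs i" and "b \<equiv> vertex vs (Suc i)"
  defines "z \<equiv> \<lambda>s t. a + of_real l * (b - a) - of_real (s * t) * \<i> * (b - a)"
  shows "\<forall>\<^sub>F t in at_right 0. z r t \<in> interior H \<and> z (- r) t \<notin> H"
proof -
  define g where "g = closed_polygonal_path vs"
  have vs: "vs \<noteq> []" "simple_path g" and H: "H = path_image g \<union> inside (path_image g)"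
    and wn: "\<And>w. w \<in> inside (path_image g) \<Longrightarrow> winding_number g w = -1"
    using cw by (auto simp: clockwise_vertices_def g_def)
  note g = closed_polygonal_path_simps[OF vs(1), folded g_def]
  define W where "W = (\<lambda>j. winding_number (linepath (vertex vs j) (vertex vs (Suc j))))"
  define S where "S = (\<lambda>j. closed_segment (vertex vs j) (vertex vs (Suc j)))"
  have ab: "a \<noteq> b"
    using cw i by (auto simp: clockwise_vertices_def a_def b_def horizontal_edge_def vertical_edge_def
       rightward_edge_def leftward_edge_def upward_edge_def downward_edge_def)
  define p where "p = a + of_real l * (b - a)"
  have p: "p = linepath a b l" by (simp add: p_def linepath_def scaleR_conv_of_real algebra_simps)
  have pS: "p \<notin> S j" if "j < length vs" "j \<noteq> i" for j
    unfolding p S_def a_def b_def using edge_point_notin_other_edge vs i l that by (auto simp: g_def)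
  have zp: "(z s \<longlongrightarrow> p) (at_right 0)" for s
  proof -
    have "(z s \<longlongrightarrow> a + of_real l * (b - a) - of_real (s * 0) * \<i> * (b - a)) (at_right 0)"
      unfolding z_def by (intro tendsto_intros)
    then show ?thesis by (simp add: p_def)
  qed
  have zS: "\<forall>\<^sub>F t in at_right 0. z s t \<notin> S j" if "j < length vs" "s \<noteq> 0" for s j
  proof (cases "j = i")
    case True
    show ?thesis
      using eventually_at_right_less[of 0]
    proof eventually_elim
      case (elim t)
      then show ?case
        using normal_displacement_notin_segment[OF ab, of "s * t" l] that True
        by (simp add: z_def S_def a_def b_def)
    qed
  next
    case False
    have "open (- S j)" unfolding S_def by (intro open_Compl closed_segment)
    then show ?thesis
      using topological_tendstoD[OF zp, of "- S j"] pS False that by auto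
  qed
  then have zg: "\<forall>\<^sub>F t in at_right 0. z s t \<notin> path_image g" if "s \<noteq> 0" for s
    using that unfolding g(3) S_def by (auto simp: eventually_ball_finite_distrib)
  have "((\<lambda>t. \<Sum>j<length vs. Re (W j (z r t)) - Re (W j (z (- r) t)))
      \<longlongrightarrow> (\<Sum>j<length vs. if j = i then - 1 else 0)) (at_right 0)"
  proof (rule tendsto_sum)
    fix j assume j: "j \<in> {..<length vs}"
    show "((\<lambda>t. Re (W j (z r t)) - Re (W j (z (- r) t))) \<longlongrightarrow> (if j = i then - 1 else 0)) (at_right 0)"
    proof (cases "j = i")
      case True
      have "((\<lambda>t. Re (W j (z r t)) - Re (W j (z (- r) t))) \<longlongrightarrow> - sgn r / 2 - - sgn (- r) / 2) (at_right 0)"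
        unfolding z_def W_def True
        using winding_number_linepath_one_sided_limit[OF ab l, of r]
          winding_number_linepath_one_sided_limit[OF ab l, of "- r"] r
        by (intro tendsto_diff) (simp_all add: a_def b_def)
      then show ?thesis using True r by simp
    next
      case False
      have "isCont (W j) p"
        unfolding W_def using pS[of j] False j by (intro continuous_at_winding_number) (auto simp: S_def)
      then have "((\<lambda>t. W j (z s t)) \<longlongrightarrow> W j p) (at_right 0)" for s
        using zp isCont_tendsto_compose by blast
      then have "((\<lambda>t. Re (W j (z r t)) - Re (W j (z (- r) t))) \<longlongrightarrow> Re (W j p) - Re (W j p)) (at_right 0)"
        by (intro tendsto_intros)
      then show ?thesis using False by simp
    qed
  qed
  then have "((\<lambda>t. \<Sum>j<length vs. Re (W j (z r t)) - Re (W j (z (- r) t))) \<longlongrightarrow> - 1) (at_right 0)"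
    using i by (simp add: sum.delta)
  then have "\<forall>\<^sub>F t in at_right 0. (\<Sum>j<length vs. Re (W j (z r t)) - Re (W j (z (- r) t))) < 0"
    by (rule order_tendstoD) simp
  moreover have "\<forall>\<^sub>F t in at_right 0. z r t \<notin> path_image g" "\<forall>\<^sub>F t in at_right 0. z (- r) t \<notin> path_image g"
    using zg r by auto
  ultimately show ?thesis
  proof eventually_elim
    case (elim t)
    have "(\<Sum>j<length vs. Re (W j (z r t)) - Re (W j (z (- r) t)))
        = Re (winding_number g (z r t)) - Re (winding_number g (z (- r) t))"
      using g(4) elim by (simp add: W_def sum_subtractf)
    then have less: "Re (winding_number g (z r t)) < Re (winding_number g (z (- r) t))"
      using elim by simp
    \<comment> \<open>Off the curve only -1 (inside) and 0 (outside) occur, so the smaller value on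
      the right decides both sides.\<close>
    have io: "w \<in> inside (path_image g) \<and> winding_number g w = -1 \<or>
        w \<notin> inside (path_image g) \<and> winding_number g w = 0" if "w \<notin> path_image g" for w
      using that wn winding_number_zero_in_outside[OF g(1,2)] inside_Un_outside[of "path_image g"]
      by blast
    have "z r t \<in> inside (path_image g)" "z (- r) t \<notin> inside (path_image g)"
      using io[of "z r t"] io[of "z (- r) t"] elim less by auto
    moreover have "inside (path_image g) \<subseteq> interior H"
      using g(1) by (intro interior_maximal) (auto simp: H open_inside closed_path_image)
    ultimately show ?case using elim H by blast
  qed
qed

text \<open>\<open>- \<i>\<close> times the edge vector is its right normal, so the sign of
  \<open>r\<close> names the side; the size of \<open>r\<close> admits unit directions whatever the
  length of the edge.\<close>

lemma interior_towards_iff: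
  assumes cw: "clockwise_vertices H vs" and i: "i < length vs" and r: "r \<noteq> 0"
    and u: "u = - of_real r * \<i> * (vertex vs (Suc i) - vertex vs i)"
  shows "interior_towards H vs i u \<longleftrightarrow> 0 < r"
proof -
  define a b where "a = vertex vs i" and "b = vertex vs (Suc i)"
  have ab: "a \<noteq> b"
    using cw i by (auto simp: clockwise_vertices_def a_def b_def horizontal_edge_def vertical_edge_def
       rightward_edge_def leftward_edge_def upward_edge_def downward_edge_def)
  have eq: "a + of_real l * (b - a) + of_real t * u = a + of_real l * (b - a) - of_real (r * t) * \<i> * (b - a)" for l t
    by (simp add: u a_def b_def algebra_simps)
  note sides = sides_of_edge[OF cw i, folded a_def b_def]
  show ?thesis
  proof
    assume int: "interior_towards H vs i u"
    show "0 < r"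
    proof (rule ccontr)
      assume "\<not> 0 < r"
      with r have r': "0 < - r" by simp
      \<comment> \<open>A single point from which the direction leaves \<open>H\<close> is a
        contradiction; the midpoint serves.\<close>
      define p where "p = a + of_real (1/2) * (b - a)"
      have "p \<in> open_segment a b"
        unfolding p_def in_segment
        by (intro conjI ab exI[of _ "1/2"]) (simp_all add: complex_eq_iff field_simps)
      then have "\<forall>\<^sub>F t in at_right 0. p + of_real t * u \<in> interior H"
        using int by (simp add: interior_towards_def a_def b_def)
      moreover have "\<forall>\<^sub>F t in at_right 0. p + of_real t * u \<notin> H"
        using sides[of "1/2" "- r"] r' unfolding p_def eq by (auto elim!: eventually_mono)
      ultimately have "\<forall>\<^sub>F t::real in at_right 0. False"
        by eventually_elim (use interior_subset in blast)
      then show False by simp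
    qed
  next
    assume r: "0 < r"
    show "interior_towards H vs i u"
      unfolding interior_towards_def
    proof
      fix p assume "p \<in> open_segment (vertex vs i) (vertex vs (i + 1))"
      then obtain l where l: "0 < l" "l < 1" and p: "p = a + of_real l * (b - a)"
        by (auto simp: in_segment a_def b_def scaleR_conv_of_real algebra_simps)
      show "\<forall>\<^sub>F t in at_right 0. p + of_real t * u \<in> interior H"
        using sides[OF l r] unfolding p eq by (auto elim!: eventually_mono)
    qed
  qed
qed

section \<open>Edge directions\<close>

text \<open>With signs in place of direction predicates, a turn becomes a polynomial expression that
  can be summed over the edges.\<close>

definition edge_dx :: "complex list \<Rightarrow> nat \<Rightarrow> real" where
  "edge_dx vs i = sgn (Re (vertex vs (Suc i) - vertex vs i))"

definition edge_dy :: "complex list \<Rightarrow> nat \<Rightarrow> real" where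
  "edge_dy vs i = sgn (Im (vertex vs (Suc i) - vertex vs i))"

lemma vertex_add_length [simp]: "vertex vs (i + length vs) = vertex vs i"
  by (simp add: vertex_def)

lemma edge_dx_add_length [simp]: "edge_dx vs (i + length vs) = edge_dx vs i"
  using vertex_add_length[of vs "Suc i"] by (simp add: edge_dx_def)

lemma edge_dy_add_length [simp]: "edge_dy vs (i + length vs) = edge_dy vs i"
  using vertex_add_length[of vs "Suc i"] by (simp add: edge_dy_def)

lemma edge_dx_mod [simp]: "edge_dx vs (i mod length vs) = edge_dx vs i"
  by (simp add: edge_dx_def)

lemma edge_dy_mod [simp]: "edge_dy vs (i mod length vs) = edge_dy vs i"
  by (simp add: edge_dy_def)

lemma edge_direction_iff:
  "rightward_edge vs i \<longleftrightarrow> edge_dx vs i = 1 \<and> edge_dy vs i = 0"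
  "leftward_edge vs i \<longleftrightarrow> edge_dx vs i = -1 \<and> edge_dy vs i = 0"
  "upward_edge vs i \<longleftrightarrow> edge_dx vs i = 0 \<and> edge_dy vs i = 1"
  "downward_edge vs i \<longleftrightarrow> edge_dx vs i = 0 \<and> edge_dy vs i = -1"
  by (auto simp: rightward_edge_def leftward_edge_def upward_edge_def downward_edge_def
      edge_dx_def edge_dy_def sgn_if split: if_splits)

lemma edges_alternate:
  assumes "clockwise_vertices H vs"
  shows "edge_dx vs i \<in> {1, -1} \<and> edge_dy vs i = 0 \<and> edge_dx vs (Suc i) = 0 \<and> edge_dy vs (Suc i) \<in> {1, -1} \<or>
    edge_dx vs i = 0 \<and> edge_dy vs i \<in> {1, -1} \<and> edge_dx vs (Suc i) \<in> {1, -1} \<and> edge_dy vs (Suc i) = 0"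
proof -
  let ?i = "i mod length vs"
  have "?i < length vs" using assms by (simp add: clockwise_vertices_def)
  then have "horizontal_edge vs ?i \<and> vertical_edge vs (?i + 1) \<or> vertical_edge vs ?i \<and> horizontal_edge vs (?i + 1)"
    using assms unfolding clockwise_vertices_def by blast
  moreover have "edge_dx vs (Suc ?i) = edge_dx vs (Suc i)" "edge_dy vs (Suc ?i) = edge_dy vs (Suc i)"
    using edge_dx_mod[of vs "Suc ?i"] edge_dx_mod[of vs "Suc i"] edge_dy_mod[of vs "Suc ?i"] edge_dy_mod[of vs "Suc i"]
    by (simp_all only: mod_Suc_eq)
  ultimately show ?thesis
    by (auto simp: horizontal_edge_def vertical_edge_def edge_direction_iff)
qed

text \<open>The index is that of the predecessor of the edge of interest, which keeps truncated
  subtraction out of the case distinction.\<close>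

lemma edge_triple_cases:
  assumes "clockwise_vertices H vs"
  obtains (vertical) "edge_dx vs i = 1 \<or> edge_dx vs i = -1" "edge_dx vs (Suc i) = 0"
      "edge_dy vs (Suc i) = 1 \<or> edge_dy vs (Suc i) = -1"
      "edge_dx vs (Suc (Suc i)) = 1 \<or> edge_dx vs (Suc (Suc i)) = -1"
    | (horizontal) "edge_dx vs i = 0" "edge_dx vs (Suc i) = 1 \<or> edge_dx vs (Suc i) = -1"
      "edge_dy vs (Suc i) = 0" "edge_dx vs (Suc (Suc i)) = 0"
proof (cases "edge_dx vs i = 0")
  case True
  then have 1: "edge_dx vs (Suc i) = 1 \<or> edge_dx vs (Suc i) = -1" "edge_dy vs (Suc i) = 0"
    using edges_alternate[OF assms, of i] by auto
  then have "edge_dx vs (Suc (Suc i)) = 0"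
    using edges_alternate[OF assms, of "Suc i"] by auto
  with True 1 show ?thesis using horizontal by blast
next
  case False
  then have 1: "edge_dx vs i = 1 \<or> edge_dx vs i = -1" "edge_dx vs (Suc i) = 0"
      "edge_dy vs (Suc i) = 1 \<or> edge_dy vs (Suc i) = -1"
    using edges_alternate[OF assms, of i] by auto
  then have "edge_dx vs (Suc (Suc i)) = 1 \<or> edge_dx vs (Suc (Suc i)) = -1"
    using edges_alternate[OF assms, of "Suc i"] by auto
  with 1 show ?thesis using vertical by blast
qed

lemma neighbours_extend_iff:
  assumes "vs \<noteq> []"
  shows "neighbours_extend_left vs i \<longleftrightarrow> edge_dx vs (i + length vs - 1) = 1 \<and> edge_dx vs (Suc i) = -1"
    "neighbours_extend_right vs i \<longleftrightarrow> edge_dx vs (i + length vs - 1) = -1 \<and> edge_dx vs (Suc i) = 1"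
    "neighbours_extend_above vs i \<longleftrightarrow> edge_dy vs (i + length vs - 1) = -1 \<and> edge_dy vs (Suc i) = 1"
proof -
  have "Suc (i + length vs - 1) = i + length vs" using assms by (cases vs) auto
  then have "vertex vs (Suc (i + length vs - 1)) = vertex vs i" by simp
  then show "neighbours_extend_left vs i \<longleftrightarrow> edge_dx vs (i + length vs - 1) = 1 \<and> edge_dx vs (Suc i) = -1"
    "neighbours_extend_right vs i \<longleftrightarrow> edge_dx vs (i + length vs - 1) = -1 \<and> edge_dx vs (Suc i) = 1"
    "neighbours_extend_above vs i \<longleftrightarrow> edge_dy vs (i + length vs - 1) = -1 \<and> edge_dy vs (Suc i) = 1"
    unfolding neighbours_extend_left_def neighbours_extend_right_def neighbours_extend_above_def
      edge_dx_def edge_dy_def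
    by (auto simp: sgn_if split: if_splits)
qed

lemma interior_side:
  assumes cw: "clockwise_vertices H vs" and i: "i < length vs"
  shows "vertical_edge vs i \<Longrightarrow> interior_towards H vs i 1 \<longleftrightarrow> edge_dy vs i = 1"
    "vertical_edge vs i \<Longrightarrow> interior_towards H vs i (-1) \<longleftrightarrow> edge_dy vs i = -1"
    "horizontal_edge vs i \<Longrightarrow> interior_towards H vs i (- \<i>) \<longleftrightarrow> edge_dx vs i = 1"
proof -
  define h where "h = vertex vs (Suc i) - vertex vs i"
  note iff = interior_towards_iff[OF cw i, folded h_def]
  {
    assume "vertical_edge vs i"
    then have h: "Re h = 0" "Im h \<noteq> 0" and dy: "edge_dy vs i = sgn (Im h)"
      by (auto simp: h_def vertical_edge_def upward_edge_def downward_edge_def edge_dy_def)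
    \<comment> \<open>The factor passed to \<open>iff\<close> scales the right normal
      \<open>- \<i> * h\<close> to the given unit direction.\<close>
    show "interior_towards H vs i 1 \<longleftrightarrow> edge_dy vs i = 1"
      using iff[of "1 / Im h" 1] h dy by (simp add: complex_eq_iff sgn_if)
    show "interior_towards H vs i (-1) \<longleftrightarrow> edge_dy vs i = -1"
      using iff[of "- 1 / Im h" "-1"] h dy by (auto simp: complex_eq_iff sgn_if field_simps)
  }
  assume "horizontal_edge vs i"
  then have h: "Im h = 0" "Re h \<noteq> 0" and dx: "edge_dx vs i = sgn (Re h)"
    by (auto simp: h_def horizontal_edge_def rightward_edge_def leftward_edge_def edge_dx_def)
  show "interior_towards H vs i (- \<i>) \<longleftrightarrow> edge_dx vs i = 1"
    using iff[of "1 / Re h" "- \<i>"] h dx by (simp add: complex_eq_iff sgn_if)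
qed

text \<open>Removes \<open>H\<close> from the edge types. Apart from the turn sum, what follows is
  combinatorics of a cyclic sequence of signs.\<close>

lemma edge_types_iff:
  assumes cw: "clockwise_vertices H vs"
  shows "rightmost_edge H vs i \<longleftrightarrow>
      i < length vs \<and> edge_dx vs (i + length vs - 1) = 1 \<and> edge_dy vs i = -1 \<and> edge_dx vs (Suc i) = -1"
    "left_notch H vs i \<longleftrightarrow>
      i < length vs \<and> edge_dx vs (i + length vs - 1) = 1 \<and> edge_dy vs i = 1 \<and> edge_dx vs (Suc i) = -1"
    "leftmost_edge H vs i \<longleftrightarrow>
      i < length vs \<and> edge_dx vs (i + length vs - 1) = -1 \<and> edge_dy vs i = 1 \<and> edge_dx vs (Suc i) = 1"
    "right_notch H vs i \<longleftrightarrow>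
      i < length vs \<and> edge_dx vs (i + length vs - 1) = -1 \<and> edge_dy vs i = -1 \<and> edge_dx vs (Suc i) = 1"
    "top_notch H vs i \<longleftrightarrow>
      i < length vs \<and> edge_dy vs (i + length vs - 1) = -1 \<and> edge_dx vs i = 1 \<and> edge_dy vs (Suc i) = 1"
    "falling_corner vs i \<longleftrightarrow>
      i < length vs \<and> edge_dy vs (i + length vs - 1) = -1 \<and> edge_dx vs i = 1"
proof -
  have vs: "vs \<noteq> []" using cw by (simp add: clockwise_vertices_def)
  have v: "vertical_edge vs i \<longleftrightarrow> edge_dy vs i \<in> {1, -1}"
    and h: "horizontal_edge vs i \<longleftrightarrow> edge_dx vs i \<in> {1, -1}"
    using edges_alternate[OF cw, of i] by (auto simp: vertical_edge_def horizontal_edge_def edge_direction_iff)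
  note side = interior_side[OF cw, of i, unfolded v h]
  note defs = rightmost_edge_def left_notch_def leftmost_edge_def right_notch_def top_notch_def
    neighbours_extend_iff[OF vs] v h
  show "rightmost_edge H vs i \<longleftrightarrow>
      i < length vs \<and> edge_dx vs (i + length vs - 1) = 1 \<and> edge_dy vs i = -1 \<and> edge_dx vs (Suc i) = -1"
    unfolding defs using side(2) by auto
  show "left_notch H vs i \<longleftrightarrow>
      i < length vs \<and> edge_dx vs (i + length vs - 1) = 1 \<and> edge_dy vs i = 1 \<and> edge_dx vs (Suc i) = -1"
    unfolding defs using side(1) by auto
  show "leftmost_edge H vs i \<longleftrightarrow>
      i < length vs \<and> edge_dx vs (i + length vs - 1) = -1 \<and> edge_dy vs i = 1 \<and> edge_dx vs (Suc i) = 1"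
    unfolding defs using side(1) by auto
  show "right_notch H vs i \<longleftrightarrow>
      i < length vs \<and> edge_dx vs (i + length vs - 1) = -1 \<and> edge_dy vs i = -1 \<and> edge_dx vs (Suc i) = 1"
    unfolding defs using side(2) by auto
  show "top_notch H vs i \<longleftrightarrow>
      i < length vs \<and> edge_dy vs (i + length vs - 1) = -1 \<and> edge_dx vs i = 1 \<and> edge_dy vs (Suc i) = 1"
    unfolding defs using side(3) by auto
  show "falling_corner vs i \<longleftrightarrow>
      i < length vs \<and> edge_dy vs (i + length vs - 1) = -1 \<and> edge_dx vs i = 1"
    using edges_alternate[OF cw, of "i + length vs - 1"] edges_alternate[OF cw, of i]
    by (auto simp: falling_corner_def edge_direction_iff)
qed

section \<open>Counting the rightmost edges\<close>

lemma turn_sum_clockwise_vertices: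
  assumes cw: "clockwise_vertices H vs"
  shows "\<bar>\<Sum>i<length vs. edge_dx vs i * edge_dy vs (Suc i) - edge_dy vs i * edge_dx vs (Suc i)\<bar> = 4"
proof -
  define n where "n = length vs"
  define w where "w = vertex vs"
  have vs: "vs \<noteq> []" "simple_path (closed_polygonal_path vs)"
    using cw by (auto simp: clockwise_vertices_def)
  have x: "edge_dx vs i = sgn (Re (w (Suc i) - w i))" and y: "edge_dy vs i = sgn (Im (w (Suc i) - w i))" for i
    by (simp_all add: edge_dx_def edge_dy_def w_def)
  have n: "2 \<le> n"
  proof (rule ccontr)
    assume "\<not> 2 \<le> n"
    then have "n = 1" using vs(1) by (auto simp: n_def not_le less_Suc_eq numeral_2_eq_2)
    then have "vertex vs 0 = vertex vs 1" by (simp add: n_def vertex_def)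
    then show False using edges_alternate[OF cw, of 0] by (simp add: edge_dx_def edge_dy_def)
  qed
  have "\<bar>\<Sum>i<n. sgn (Im (cnj (w (Suc i) - w i) * (w (Suc (Suc i)) - w (Suc i))))\<bar> = 4"
  proof (rule perpendicular_polygon_turning_number[OF n])
    show "w (i + n) = w i" for i by (simp add: w_def n_def)
    show "w (Suc i) - w i \<noteq> 0" for i
      using edges_alternate[OF cw, of i] unfolding x y by auto
    show "Re (cnj (w (Suc i) - w i) * (w (Suc (Suc i)) - w (Suc i))) = 0" for i
      using edges_alternate[OF cw, of i] unfolding x y by (auto simp: sgn_zero_iff)
    show "i = j \<and> u = v" if "i < n" "j < n" "0 \<le> u" "u < 1" "0 \<le> v" "v < 1"
      "w i + of_real u * (w (Suc i) - w i) = w j + of_real v * (w (Suc j) - w j)" for i j u v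
    proof (rule simple_closed_polygonal_path_inj[OF vs])
      show "linepath (vertex vs i) (vertex vs (Suc i)) u = linepath (vertex vs j) (vertex vs (Suc j)) v"
        using that(7) by (simp add: linepath_def w_def scaleR_conv_of_real algebra_simps)
    qed (use that in \<open>simp_all add: n_def\<close>)
  qed
  moreover have "sgn (Im (cnj (w (Suc i) - w i) * (w (Suc (Suc i)) - w (Suc i))))
      = edge_dx vs i * edge_dy vs (Suc i) - edge_dy vs i * edge_dx vs (Suc i)" for i
  proof -
    \<comment> \<open>One of the two products vanishes, so \<open>sgn\<close> passes through the
      difference.\<close>
    have "sgn (Im (cnj a * b)) = sgn (Re a) * sgn (Im b) - sgn (Im a) * sgn (Re b)"
      if "sgn (Re a) = 0 \<and> sgn (Im b) = 0 \<or> sgn (Im a) = 0 \<and> sgn (Re b) = 0" for a b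
      using that by (auto simp: sgn_zero_iff sgn_mult)
    then show ?thesis using edges_alternate[OF cw, of i] unfolding x y by blast
  qed
  ultimately show ?thesis by (simp add: n_def)
qed

text \<open>Each vertex lies on one vertical edge, so the turns can be grouped by vertical edges:
  direction \<open>y\<close> between horizontal directions \<open>x\<close> and \<open>x'\<close>
  accounts for \<open>y * (x - x')\<close>, which vanishes unless the horizontal direction
  reverses.\<close>

lemma card_rightmost_edge:
  assumes cw: "clockwise_vertices H vs" and no: "\<nexists>i. right_notch H vs i"
  shows "card {i. rightmost_edge H vs i} = 1"
proof -
  define n where "n = length vs"
  define x where "x = edge_dx vs"
  define y where "y = edge_dy vs"
  have n: "0 < n" using cw by (simp add: n_def clockwise_vertices_def)
  have px: "x (i + n) = x i" and py: "y (i + n) = y i" for i by (simp_all add: x_def y_def n_def)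
  have pred: "Suc (i + n - 1) = i + n" for i using n by simp
  have px': "x (Suc (i + n)) = x (Suc i)" and py': "y (Suc (i + n)) = y (Suc i)"
    and px'': "x (i + n + n - 1) = x (i + n - 1)" for i
    using px[of "Suc i"] py[of "Suc i"] px[of "i + n - 1"] n by simp_all
  \<comment> \<open>Weighting the horizontal change of direction across each vertical edge by \<open>1 - y\<close> rather than
    by \<open>y\<close> does not affect the total, as the unweighted changes telescope, but removes the upward edges.\<close>
  have summand: "(1 - y i) * (x (i + n - 1) - x (Suc i)) = (if rightmost_edge H vs i then 4 else 0)" if "i < n" for i
  proof -
    have iff: "rightmost_edge H vs i \<longleftrightarrow> x (i + n - 1) = 1 \<and> y i = -1 \<and> x (Suc i) = -1"
      and notch: "\<not> (x (i + n - 1) = -1 \<and> y i = -1 \<and> x (Suc i) = 1)"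
      using that no edge_types_iff(1,4)[OF cw, of i, folded x_def y_def n_def] by blast+
    show ?thesis
    proof (cases rule: edge_triple_cases[OF cw, of "i + n - 1", folded x_def y_def, unfolded pred px py px' py'])
      case 1
      then show ?thesis unfolding iff using notch by (elim disjE) simp_all
    next
      case 2
      then show ?thesis unfolding iff by simp
    qed
  qed
  have "(\<Sum>i<n. (1 - y i) * (x (i + n - 1) - x (Suc i))) = (\<Sum>i<n. if rightmost_edge H vs i then 4 else 0)"
    using summand by (intro sum.cong) auto
  also have "\<dots> = 4 * card {i \<in> {..<n}. rightmost_edge H vs i}"
    by (simp flip: sum.inter_filter)
  also have "{i \<in> {..<n}. rightmost_edge H vs i} = {i. rightmost_edge H vs i}"
    by (auto simp: rightmost_edge_def n_def)
  finally have card: "(\<Sum>i<n. (1 - y i) * (x (i + n - 1) - x (Suc i))) = 4 * card {i. rightmost_edge H vs i}" .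
  have s1: "(\<Sum>i<n. x (i + n - 1)) = (\<Sum>i<n. x i)"
    using sum_cyclic_shift[of x n "n - 1"] px n by simp
  have s2: "(\<Sum>i<n. x (Suc i)) = (\<Sum>i<n. x i)"
    using sum_cyclic_shift[of x n 1] px by simp
  \<comment> \<open>The turn at the start of a vertical edge is reindexed by the preceding edge, as
    in the turn sum.\<close>
  have s3: "(\<Sum>i<n. y i * x (i + n - 1)) = (\<Sum>i<n. y (Suc i) * x i)"
    using sum_cyclic_shift[of "\<lambda>i. y i * x (i + n - 1)" n 1] px py px'' by simp
  have "(\<Sum>i<n. (1 - y i) * (x (i + n - 1) - x (Suc i)))
      = (\<Sum>i<n. x (i + n - 1)) - (\<Sum>i<n. x (Suc i)) - ((\<Sum>i<n. y i * x (i + n - 1)) - (\<Sum>i<n. y i * x (Suc i)))"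
    by (simp add: algebra_simps sum.distrib sum_subtractf)
  also have "\<dots> = - (\<Sum>i<n. x i * y (Suc i) - y i * x (Suc i))"
    unfolding s1 s2 s3 by (simp add: sum_subtractf mult.commute)
  \<comment> \<open>The left side is nonnegative, which settles the sign that the turning number
    leaves open.\<close>
  finally have "real (4 * card {i. rightmost_edge H vs i}) = \<bar>\<Sum>i<n. x i * y (Suc i) - y i * x (Suc i)\<bar>"
    using card by simp
  then show ?thesis
    using turn_sum_clockwise_vertices[OF cw, folded n_def x_def y_def] by simp
qed

section \<open>The order of the edges along the tour\<close>

text \<open>An element appended to the list whose turn is next becomes the last element of the
  splice; this lets the alternation grow edge by edge.\<close>

lemma splice_snoc:
  shows splice_snoc_right: "length xs = Suc (length ys) \<Longrightarrow> splice xs ys @ [z] = splice xs (ys @ [z])"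
    and splice_snoc_left: "length xs = length ys \<Longrightarrow> splice xs ys @ [z] = splice (xs @ [z]) ys"
  by (induction xs ys rule: splice.induct) auto

text \<open>Unrolls the rotation into consecutive numbers, so that initial stretches of the tour
  admit induction.\<close>

lemma edge_tour_eq_map:
  assumes "r < length vs"
  shows "edge_tour vs r = map (\<lambda>j. j mod length vs) [r..<Suc (r + length vs)]"
proof -
  let ?n = "length vs"
  have "rotate r [0..<?n] = map (\<lambda>j. j mod ?n) [r..<r + ?n]"
  proof (rule nth_equalityI)
    fix i assume "i < length (rotate r [0..<?n])"
    moreover have "(r + i) mod ?n < ?n" using assms by (intro mod_less_divisor) linarith
    ultimately show "rotate r [0..<?n] ! i = map (\<lambda>j. j mod ?n) [r..<r + ?n] ! i"
      by (simp add: nth_rotate)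
  qed simp
  then show ?thesis using assms by (simp add: edge_tour_def)
qed

text \<open>As \<open>R # Ns\<close> and \<open>Ls\<close> have equal length, the splice alternates
  strictly to its end and displays the asserted order.\<close>

theorem mainTheorem7:
  fixes H :: "complex set" and vs :: "complex list" and R :: nat and Ls Ns :: "nat list"
  assumes "BLS_hole H"
    and "clockwise_vertices H vs"
    and "rightmost_edge H vs R"
    and "Ls = filter (leftmost_edge H vs) (edge_tour vs R)"
    and "Ns = filter (left_notch H vs) (edge_tour vs R)"
  shows "length Ls = length Ns + 1 \<and>
    filter (\<lambda>e. e \<in> {R} \<union> set Ls \<union> set Ns) (edge_tour vs R) = splice (R # Ns) Ls @ [R] \<and>
    (\<forall>c. falling_corner vs c \<longrightarrow> steps_from vs R (last Ls) < steps_from vs R c)"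
proof -
  define n where "n = length vs"
  define x where "x = edge_dx vs"
  define y where "y = edge_dy vs"
  note cw = assms(2)
  have no_right: "\<nexists>i. right_notch H vs i" and no_top: "\<nexists>i. top_notch H vs i"
    and falling: "card {i. falling_corner vs i} \<le> 1"
    using assms(1) cw by (auto simp: BLS_hole_def)
  note types = edge_types_iff[OF cw, folded x_def y_def n_def]
  note alt = edges_alternate[OF cw, folded x_def y_def]
  have n: "0 < n" using cw by (simp add: n_def clockwise_vertices_def)
  have px: "x (i + n) = x i" and py: "y (i + n) = y i"
    and xmod: "x (i mod n) = x i" and ymod: "y (i mod n) = y i" for i
    by (simp_all add: x_def y_def n_def)
  have xSmod: "x (Suc (i mod n)) = x (Suc i)" and ySmod: "y (Suc (i mod n)) = y (Suc i)" for i
    by (metis xmod mod_Suc_eq) (metis ymod mod_Suc_eq)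
  have pmod: "(i mod n + n - 1) mod n = (i - 1) mod n" if "0 < i" for i
  proof -
    have "(i mod n + n - 1) mod n = (i mod n + (n - 1)) mod n" using n by simp
    also have "\<dots> = (i + (n - 1)) mod n" by (simp add: mod_add_left_eq)
    also have "i + (n - 1) = i - 1 + n" using n that by simp
    finally show ?thesis by simp
  qed
  have xpmod: "x (i mod n + n - 1) = x (i - 1)" and ypmod: "y (i mod n + n - 1) = y (i - 1)" if "0 < i" for i
    by (metis xmod pmod that) (metis ymod pmod that)
  have R: "R < n" "x (R + n - 1) = 1" "y R = -1" "x (Suc R) = -1" "x R = 0"
    using assms(3) alt[of R] by (auto simp: types)
  \<comment> \<open>Otherwise the predecessor of \<open>R\<close> would be \<open>R\<close> or its
    successor, with conflicting directions. The bound later separates vertices two steps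
    apart.\<close>
  have n3: "3 \<le> n"
  proof (rule ccontr)
    assume "\<not> 3 \<le> n"
    with n have "n = 1 \<or> n = 2" by auto
    then have "R + n - 1 = R \<or> R + n - 1 = Suc R" by auto
    then show False using R by auto
  qed
  have unique: "i = R" if "rightmost_edge H vs i" for i
    using card_rightmost_edge[OF cw no_right] assms(3) that
    by (metis One_nat_def card_1_singletonE mem_Collect_eq singletonD)
  let ?A = "\<lambda>e. e = R \<or> leftmost_edge H vs e \<or> left_notch H vs e"
  \<comment> \<open>The final return to \<open>R\<close> is left out, so \<open>R\<close> occurs
    once, at the front.\<close>
  define tour where "tour = (\<lambda>m. map (\<lambda>j. j mod n) [R..<R + m])"
  define F where "F = (\<lambda>m. filter (leftmost_edge H vs) (tour m))"
  define G where "G = (\<lambda>m. filter (left_notch H vs) (tour m))"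
  define A where "A = (\<lambda>m. filter ?A (tour m))"
  \<comment> \<open>One of the two summands below vanishes; their sum is the direction of the horizontal edge at or
    just before position \<open>m\<close>.\<close>
  have inv: "A m = splice (R # G m) (F m) \<and>
      (x (R + m - 1) + x (R + m) = -1 \<and> length (F m) = length (G m) \<or>
       x (R + m - 1) + x (R + m) = 1 \<and> length (F m) = Suc (length (G m)))" if "1 \<le> m" "m \<le> n" for m
    using that
  proof (induction m rule: dec_induct)
    case base
    have "tour 1 = [R]" using R by (simp add: tour_def)
    moreover have "\<not> leftmost_edge H vs R" "\<not> left_notch H vs R" using R by (auto simp: types)
    ultimately show ?case using R by (simp add: A_def F_def G_def)
  next
    case (step m)
    define e where "e = (R + m) mod n"
    have e: "e < n" "e \<noteq> R"
    proof -
      show "e < n" using n by (simp add: e_def)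
      show "e \<noteq> R"
      proof
        assume "e = R"
        then have "(R + m) mod n = (R + 0) mod n" using R by (simp add: e_def)
        then have "[m = 0] (mod n)" unfolding cong_def[symmetric] cong_add_lcancel_nat .
        then show False using step cong_less_modulus_unique_nat[of m 0 n] by simp
      qed
    qed
    have tour: "tour (Suc m) = tour m @ [e]" by (simp add: tour_def e_def)
    have xy: "x (e + n - 1) = x (R + m - 1)" "x e = x (R + m)" "x (Suc e) = x (Suc (R + m))" "y e = y (R + m)"
      using step xpmod[of "R + m"] by (simp_all add: e_def xmod ymod xSmod)
    have lm: "leftmost_edge H vs e \<longleftrightarrow> x (R + m - 1) = -1 \<and> y (R + m) = 1 \<and> x (Suc (R + m)) = 1"
      and ln: "left_notch H vs e \<longleftrightarrow> x (R + m - 1) = 1 \<and> y (R + m) = 1 \<and> x (Suc (R + m)) = -1"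
      using e by (simp_all only: types xy simp_thms)
    \<comment> \<open>Away from \<open>R\<close>, uniqueness rules out the pattern of a rightmost
      edge.\<close>
    have nrm: "\<not> (x (R + m - 1) = 1 \<and> y (R + m) = -1 \<and> x (Suc (R + m)) = -1)"
      and nrn: "\<not> (x (R + m - 1) = -1 \<and> y (R + m) = -1 \<and> x (Suc (R + m)) = 1)"
      using unique[of e] no_right e by (auto simp only: types xy simp_thms)
    have IH: "A m = splice (R # G m) (F m)"
      "x (R + m - 1) + x (R + m) = -1 \<and> length (F m) = length (G m) \<or>
       x (R + m - 1) + x (R + m) = 1 \<and> length (F m) = Suc (length (G m))"
      using step by auto
    have FS: "F (Suc m) = F m @ (if leftmost_edge H vs e then [e] else [])"
      and GS: "G (Suc m) = G m @ (if left_notch H vs e then [e] else [])"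
      and AS: "A (Suc m) = A m @ (if leftmost_edge H vs e \<or> left_notch H vs e then [e] else [])"
      using e by (simp_all add: F_def G_def A_def tour)
    have S: "Suc (R + m - 1) = R + m" using step by simp
    note triple = edge_triple_cases[OF cw, of "R + m - 1", folded x_def y_def, unfolded S]
    consider "leftmost_edge H vs e" | "left_notch H vs e" | "\<not> leftmost_edge H vs e" "\<not> left_notch H vs e" by blast
    then show ?case
    proof cases
      case 1
      \<comment> \<open>A leftmost edge is vertical and entered heading left, so the invariant gives
        equal counts and the turn is that of \<open>F\<close>. For a left notch the roles are
        reversed.\<close>
      then have "x (R + m) = 0" using lm by (cases rule: triple) auto
      with 1 have "length (F m) = length (G m)" "\<not> left_notch H vs e" "x (R + m) = 0"
        using IH(2) unfolding lm ln by auto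
      then show ?thesis
        using 1 IH(1) lm by (simp add: FS GS AS splice_snoc)
    next
      case 2
      then have "x (R + m) = 0" using ln by (cases rule: triple) auto
      with 2 have "length (F m) = Suc (length (G m))" "\<not> leftmost_edge H vs e" "x (R + m) = 0"
        using IH(2) unfolding lm ln by auto
      then show ?thesis
        using 2 IH(1) ln by (simp add: FS GS AS splice_snoc)
    next
      case 3
      \<comment> \<open>Of the four types that reverse the horizontal heading none is left, so the
        heading persists.\<close>
      then have "x (R + m) + x (Suc (R + m)) = x (R + m - 1) + x (R + m)"
      proof (cases rule: triple)
        case 1
        then show ?thesis using 3 nrm nrn unfolding lm ln by (elim disjE) simp_all
      next
        case 2
        then show ?thesis by simp
      qed
      then show ?thesis
        using 3 IH by (simp add: FS GS AS add.commute)
    qed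
  qed
  have tour: "edge_tour vs R = tour n @ [R]"
    using edge_tour_eq_map[of R vs] R by (simp add: tour_def n_def)
  have Rn: "\<not> leftmost_edge H vs R" "\<not> left_notch H vs R" using R by (auto simp: types)
  then have Ls: "Ls = F n" and Ns: "Ns = G n"
    using assms(4,5) by (simp_all add: tour F_def G_def)
  \<comment> \<open>The edge leading into \<open>R\<close> is rightward, which selects the second
    alternative of the invariant.\<close>
  have "x (R + n - 1) + x (R + n) = 1" using R px by simp
  then have An: "A n = splice (R # Ns) Ls" and len: "length Ls = Suc (length Ns)"
    using inv[of n] n Ls Ns by auto
  have "filter (\<lambda>e. e \<in> {R} \<union> set Ls \<union> set Ns) (edge_tour vs R) = filter ?A (edge_tour vs R)"
    using assms(4,5) by (intro filter_cong) auto
  also have "\<dots> = splice (R # Ns) Ls @ [R]"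
    using An by (simp add: tour A_def)
  finally have order: "filter (\<lambda>e. e \<in> {R} \<union> set Ls \<union> set Ns) (edge_tour vs R) = splice (R # Ns) Ls @ [R]" .
  have "steps_from vs R (last Ls) < steps_from vs R c" if c: "falling_corner vs c" for c
  proof -
    have c': "c < n" "y (c + n - 1) = -1" "x c = 1" using c by (auto simp: types)
    have ySc: "y (Suc c) = -1"
      using alt[of c] c' no_top types(5)[of c] by auto
    define e where "e = Suc c mod n"
    have e: "e < n" "x (e + n - 1) = 1" "y e = -1" "x (Suc e) = x (Suc (Suc c))"
      using n c' ySc xpmod[of "Suc c"] by (simp_all add: e_def ymod xSmod)
    have "x (Suc (Suc c)) = -1"
    \<comment> \<open>Edge \<open>Suc c\<close> is downward, so a rightward edge after it would
      start at a second falling corner, distinct from \<open>c\<close> because \<open>n\<close> is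
      at least 3.\<close>
    proof (rule ccontr)
      assume "x (Suc (Suc c)) \<noteq> -1"
      then have "x (Suc (Suc c)) = 1" using alt[of "Suc c"] ySc by auto
      then have "falling_corner vs (Suc (Suc c) mod n)"
        using n ySc ypmod[of "Suc (Suc c)"] by (simp add: types xmod)
      then have "Suc (Suc c) mod n = c"
        using c falling card_le_Suc0_iff_eq[of "{i. falling_corner vs i}"]
        by (simp add: falling_corner_def)
      then show False using c'(1) n3 by (auto simp: mod_if split: if_splits)
    qed
    then have "e = R" using e by (intro unique) (simp add: types)
    then have "Suc c mod n = R" by (simp add: e_def)
    then have steps_c: "steps_from vs R c = n - 1"
      using c'(1) n by (auto simp: steps_from_def mod_Suc simp flip: n_def split: if_splits)
    have "last Ls \<in> set Ls" using len by (cases Ls) auto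
    then have L: "leftmost_edge H vs (last Ls)" using assms(4) by simp
    have "last Ls < n" "x (last Ls) = 0"
      using L alt[of "last Ls"] by (auto simp: types)
    \<comment> \<open>The maximal count \<open>n - 1\<close> belongs to the predecessor of
      \<open>R\<close>, which is horizontal, whereas \<open>last Ls\<close> is vertical.\<close>
    have "steps_from vs R (last Ls) \<noteq> n - 1"
    proof
      assume *: "steps_from vs R (last Ls) = n - 1"
      have "last Ls = (R + n - 1) mod n"
      proof (cases "R \<le> last Ls")
        case True
        then have "last Ls + n - R = last Ls - R + n" by simp
        then have "steps_from vs R (last Ls) = last Ls - R"
          unfolding steps_from_def n_def[symmetric] using \<open>last Ls < n\<close>
          by (metis less_imp_diff_less mod_add_self2 mod_less)
        then have "last Ls - R = n - 1" using * by linarith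
        then have "R = 0" "last Ls = n - 1" using \<open>last Ls < n\<close> True by linarith+
        then show ?thesis using n by simp
      next
        case False
        then have "last Ls + n - R < n" using R(1) by linarith
        then have "last Ls + n - R = n - 1"
          using * unfolding steps_from_def n_def[symmetric] by (metis mod_less)
        then have "R + n - 1 = last Ls + n" using False R(1) by linarith
        then show ?thesis using \<open>last Ls < n\<close> by (metis mod_add_self2 mod_less)
      qed
      then show False using \<open>x (last Ls) = 0\<close> R(2) xmod by simp
    qed
    moreover have "steps_from vs R (last Ls) < n"
      using n by (simp add: steps_from_def flip: n_def)
    ultimately show ?thesis using steps_c by simp
  qed
  then show ?thesis using len order by simp
qed

end
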